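(* Let $p\ge1$ and let $(\boldsymbol c^{p-1},X^{p-1})$ be such that $\boldsymbol c_K^{p-1}=(c_{i,K}^{p-1})_{i}\in\mathcal A$ for all $1\le K\le N$ and $X^{p-1}\in[0,1]$ with $1<K^{p-1}<N$. Let $(\boldsymbol c^p,X^p)$ be a solution to the modified scheme $(\widetilde S)$. Then $$c_{i,K}^p\ge0\quad\forall i\in\{1,\dots,n\},\ \forall K\in\{1,\dots,N\},$$ $$\sum_{i=1}^nc_{i,K}^p=1\quad\forall K\in\{1,\dots,N\},$$ $$\sum_{K=1}^N\Delta_K^pc_{i,K}^p=\sum_{K=1}^N\Delta_K^{p-1}c_{i,K}^{p-1}\quad\forall i\in\{1,\dots,n\}.$$ In particular, $\boldsymbol J^{p,\star,s}_{K^{p-1}+\frac12}=\boldsymbol J^{p,\star,g}_{K^{p-1}+\frac12}$ and $(\boldsymbol c_K^{p,\star})^\diamond=\boldsymbol c_K^{p,\star}$ for all $K\in\{1,\dots,N\}$, so that $(\boldsymbol c^p,X^p)$ is also a solution to the scheme $(S)$. In addition, the Stefan–Maxwell linear systems can be inverted, i.e. $\check{\widetilde{\boldsymbol A}}_g(\boldsymbol c^{p,\star}_{K+\frac12})$ is invertible for all $K^{p-1}<K\le N-1$.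
   Context: Parameters. $n\ge2$; $\mathcal A=\{\boldsymbol c\in\mathbb R_+^n:\sum_ic_i=1\}$. For $\alpha\in\{s,g\}$ (solid, gas) let $\kappa_{ij}^\alpha=\kappa_{ji}^\alpha>0$ for $i\neq j$, $\kappa^{*,\alpha}=\min_{i\ne j}\kappa^\alpha_{ij}>0$, $\bar\kappa^\alpha_{ij}=\kappa^\alpha_{ij}-\kappa^{*,\alpha}\ge0$ for $i\ne j$. For $\boldsymbol u\in\mathbb R^n$ let $\bar{\boldsymbol A}_\alpha(\boldsymbol u)\in\mathbb R^{n\times n}$ have entries $(\bar{\boldsymbol A}_\alpha)_{ii}(\boldsymbol u)=\sum_{j\ne i}\bar\kappa^\alpha_{ij}u_j$ and $(\bar{\boldsymbol A}_\alpha)_{ij}(\boldsymbol u)=-\bar\kappa^\alpha_{ij}u_i$ for $i\ne j$. Set $\widehat{\boldsymbol A}_s(\boldsymbol u)=\bar{\boldsymbol A}_s(\boldsymbol u)+\kappa^{*,s}\boldsymbol I$ and $\check{\widetilde{\boldsymbol A}}_g(\boldsymbol u)=\bar{\boldsymbol A}_g(\boldsymbol u)+\kappa^{*,g}\boldsymbol I$. Let $\boldsymbol\mu^{*,s},\boldsymbol\mu^{*,g}\in\mathbb R^n$ and $\beta_i^*=\exp(\mu_i^{*,g}-\mu_i^{*,s})$. Mesh. $N\in\mathbb N^*$, $\Delta x=1/N$, $x_{K+\frac12}=K\Delta x$ for $0\le K\le N$. For interface positions $X^{p-1},X^p\in[0,1]$, $K^{q}\in\{0,\dots,N\}$ ($q\in\{p-1,p\}$)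 denotes the lowest integer minimizing $K\mapsto|x_{K+\frac12}-X^{q}|$. Cell sizes: $\Delta^q_{K^q}=X^q-x_{K^q-\frac12}$, $\Delta^q_{K^q+1}=x_{K^q+\frac32}-X^q$, $\Delta^q_K=\Delta x$ otherwise. Intermediate cell sizes: $\Delta^{p,\star}_{K^{p-1}}=X^p-x_{K^{p-1}-\frac12}$, $\Delta^{p,\star}_{K^{p-1}+1}=x_{K^{p-1}+\frac32}-X^p$, $\Delta^{p,\star}_K=\Delta x$ otherwise. Standing assumption on the time step: $0<\Delta t<\Delta x/(2C)$ with $C=\max_i2\cosh\big(\tfrac12(\mu_i^{*,g}-\mu_i^{*,s})\big)$. Notation. For $\boldsymbol c=(c_{i,K})\in(\mathbb R^n)^N$, $\boldsymbol c_K=(c_{i,K})_i$ and $D_{K+\frac12}\boldsymbol c=\boldsymbol c_{K+1}-\boldsymbol c_K$. Edge values $\boldsymbol c_{K+\frac12}=(c_{i,K+\frac12})_i$, $1\le K\le N-1$: $c_{i,K+\frac12}=0$ if $\min(c_{i,K},c_{i,K+1})\le0$; $=c_{i,K}$ if $0<c_{i,K}=c_{i,K+1}$; $=\frac{c_{i,K}-c_{i,K+1}}{\log c_{i,K}-\log c_{i,K+1}}$ otherwise. For $\boldsymbol x\in\mathbb R^n$, $\boldsymbol x^\diamond\in\mathbb R^n$ has components $x_i^\diamond=x_i^+/\max(1,\sum_jx_j^+)$, $x^+=\max(x,0)$; $c^\diamond_{i,K}$ denotes the $i$-th component of $(\boldsymbol c_K)^\diamond$. Scheme $(S)$ (one time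 step). Given $(\boldsymbol c^{p-1},X^{p-1})$ with $1<K^{p-1}<N$, find $\boldsymbol c^{p,\star}\in(\mathbb R^n)^N$, $X^p\in[0,1]$ and fluxes $\boldsymbol J^{p,\star}_{K+\frac12}\in\mathbb R^n$, $0\le K\le N$, such that for all $i$ and $1\le K\le N$ $$\tfrac1{\Delta t}\big(\Delta_K^{p,\star}c^{p,\star}_{i,K}-\Delta_K^{p-1}c^{p-1}_{i,K}\big)+J^{p,\star}_{i,K+\frac12}-J^{p,\star}_{i,K-\frac12}=0,\qquad(\mathrm{CL})$$ with $\boldsymbol J^{p,\star}_{\frac12}=\boldsymbol J^{p,\star}_{N+\frac12}=0$; $\Delta x\,\boldsymbol J^{p,\star}_{K+\frac12}=-\widehat{\boldsymbol A}_s(\boldsymbol c^{p,\star}_{K+\frac12})D_{K+\frac12}\boldsymbol c^{p,\star}$ for $1\le K<K^{p-1}$; the Stefan–Maxwell linear system $\Delta x\,\check{\widetilde{\boldsymbol A}}_g(\boldsymbol c^{p,\star}_{K+\frac12})\boldsymbol J^{p,\star}_{K+\frac12}=-D_{K+\frac12}\boldsymbol c^{p,\star}$ for $K^{p-1}<K\le N-1$ (where $\boldsymbol J^{p,\star}_{K+\frac12}$ may be any solution); $\boldsymbol J^{p,\star}_{K^{p-1}+\frac12}=-\boldsymbol F^{p,\star}$, where $F^{p,\star}_i=\sqrt{\beta_i^*}\,c^{p,\star}_{i,K^{p-1}+1}-\frac1{\sqrt{\beta_i^*}}c^{p,\star}_{i,K^{p-1}}$; and $X^p=X^{p-1}+\Delta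 t\sum_{i=1}^nF_i^{p,\star}$. Modified scheme $(\widetilde S)$. Same as $(S)$ except that, with $\widetilde F_i^{p,\star}=\sqrt{\beta_i^*}\,(c^{p,\star}_{i,K^{p-1}+1})^\diamond-\frac1{\sqrt{\beta_i^*}}(c^{p,\star}_{i,K^{p-1}})^\diamond$, the interface moves by $X^p=X^{p-1}+\Delta t\sum_i\widetilde F_i^{p,\star}$, and the flux at $K^{p-1}+\frac12$ is replaced by $\boldsymbol J^{p,\star,s}_{K^{p-1}+\frac12}=-\big(\sum_jc^{p,\star}_{j,K^{p-1}}\big)\widetilde{\boldsymbol F}^{p,\star}$ in equation (CL) for the cell $K=K^{p-1}$ and by $\boldsymbol J^{p,\star,g}_{K^{p-1}+\frac12}=-\big(\sum_jc^{p,\star}_{j,K^{p-1}+1}\big)\widetilde{\boldsymbol F}^{p,\star}$ in equation (CL) for the cell $K=K^{p-1}+1$. Post-processing (both schemes), defining $\boldsymbol c^p$ from $(\boldsymbol c^{p,\star},X^p)$. By the time-step assumption $|K^p-K^{p-1}|\le1$. If $K^p=K^{p-1}$: $\boldsymbol c^p=\boldsymbol c^{p,\star}$. If $K^p=K^{p-1}+1<N$: $c^p_{i,K^{p-1}}=c^p_{i,K^{p-1}+1}=c^{p,\star}_{i,K^{p-1}}$, $c^p_{i,K^p+1}=\frac{\Delta^{p,\star}_{K^p}c^{p,\star}_{i,K^p}+\Delta x\,c^{p,\star}_{i,K^p+1}}{\Delta x+\Delta^{p,\star}_{K^p}}$, and $c^p_{i,K}=c^{p,\star}_{i,K}$ for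 the other $K$. If $K^p=K^{p-1}-1>1$, symmetrically: $c^p_{i,K^{p-1}}=c^p_{i,K^{p-1}+1}=c^{p,\star}_{i,K^{p-1}+1}$, $c^p_{i,K^{p-1}-1}=\frac{\Delta x\,c^{p,\star}_{i,K^{p-1}-1}+\Delta^{p,\star}_{K^{p-1}}c^{p,\star}_{i,K^{p-1}}}{\Delta x+\Delta^{p,\star}_{K^{p-1}}}$, and $c^p_{i,K}=c^{p,\star}_{i,K}$ for the other $K$. A solution $(\boldsymbol c^p,X^p)$ is the outcome of this procedure, with $1<K^p<N$. *)

theory Defs
  imports "HOL-Analysis.Analysis"
begin

text \<open>
  The finite type \<open>'n\<close> indexes the species. A family of cell values is a function
  \<open>c :: nat \<Rightarrow> real ^ 'n\<close> of which only the values at \<open>1, \<dots>, N\<close> matter. Quantities attached to an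
  edge carry its integer part as index: \<open>J K\<close> is the flux through the edge \<open>K + 1/2\<close>, and
  \<open>edge N K\<close> is the position \<open>x\<^bsub>K+1/2\<^esub>\<close>.
\<close>

definition admissible :: "(real ^ 'n) set" where
  "admissible = {c. (\<forall>i. 0 \<le> c $ i) \<and> (\<Sum>i\<in>UNIV. c $ i) = 1}"


subsection \<open>Cross-diffusion matrices\<close>

text \<open>The diagonal entries of \<open>\<kappa>\<close> are never used.\<close>

definition kappa_min :: "('n::finite \<Rightarrow> 'n \<Rightarrow> real) \<Rightarrow> real" where
  "kappa_min \<kappa> = Min {\<kappa> i j |i j. i \<noteq> j}"

definition kappa_bar :: "('n::finite \<Rightarrow> 'n \<Rightarrow> real) \<Rightarrow> 'n \<Rightarrow> 'n \<Rightarrow> real" where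
  "kappa_bar \<kappa> i j = \<kappa> i j - kappa_min \<kappa>"

definition A_bar :: "('n::finite \<Rightarrow> 'n \<Rightarrow> real) \<Rightarrow> real ^ 'n \<Rightarrow> real ^ 'n ^ 'n" where
  "A_bar \<kappa> u = (\<chi> i j. if i = j then (\<Sum>l\<in>UNIV - {i}. kappa_bar \<kappa> i l * u $ l)
                        else - kappa_bar \<kappa> i j * u $ i)"

text \<open>
  With the solid coefficients this is the diffusion matrix of the solid phase, with the gas
  coefficients the Stefan--Maxwell matrix of the gas phase.
\<close>

definition A_reg :: "('n::finite \<Rightarrow> 'n \<Rightarrow> real) \<Rightarrow> real ^ 'n \<Rightarrow> real ^ 'n ^ 'n" where
  "A_reg \<kappa> u = A_bar \<kappa> u + kappa_min \<kappa> *\<^sub>R mat 1"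


subsection \<open>Mesh\<close>

definition dx :: "nat \<Rightarrow> real" where
  "dx N = 1 / real N"

definition edge :: "nat \<Rightarrow> nat \<Rightarrow> real" where
  "edge N K = real K * dx N"

definition interface_index :: "nat \<Rightarrow> real \<Rightarrow> nat" where
  "interface_index N X = (LEAST K. is_arg_min (\<lambda>K. \<bar>edge N K - X\<bar>) (\<lambda>K. K \<le> N) K)"

text \<open>
  Size of the cell \<open>K\<close> when the edge \<open>k + 1/2\<close> is moved to \<open>X\<close>. The sizes at the discrete time
  \<open>q\<close> use the index of \<open>X\<^sup>q\<close> for \<open>k\<close>; the intermediate sizes use the new position with the old index.
\<close>

definition moved_cell_size :: "nat \<Rightarrow> nat \<Rightarrow> real \<Rightarrow> nat \<Rightarrow> real" where
  "moved_cell_size N k X K =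
     (if K = k then X - edge N (k - 1)
      else if K = k + 1 then edge N (k + 1) - X
      else dx N)"

definition cell_size :: "nat \<Rightarrow> real \<Rightarrow> nat \<Rightarrow> real" where
  "cell_size N X = moved_cell_size N (interface_index N X) X"

definition star_cell_size :: "nat \<Rightarrow> real \<Rightarrow> real \<Rightarrow> nat \<Rightarrow> real" where
  "star_cell_size N X_old X = moved_cell_size N (interface_index N X_old) X"


subsection \<open>Edge values, truncation and interface fluxes\<close>

definition log_mean :: "real \<Rightarrow> real \<Rightarrow> real" where
  "log_mean a b =
     (if min a b \<le> 0 then 0 else if a = b then a else (a - b) / (ln a - ln b))"

definition edge_value :: "(nat \<Rightarrow> real ^ 'n) \<Rightarrow> nat \<Rightarrow> real ^ 'n" where
  "edge_value c K = (\<chi> i. log_mean (c K $ i) (c (K + 1) $ i))"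

definition jump :: "(nat \<Rightarrow> real ^ 'n) \<Rightarrow> nat \<Rightarrow> real ^ 'n" where
  "jump c K = c (K + 1) - c K"

definition diamond :: "real ^ 'n \<Rightarrow> real ^ 'n" where
  "diamond x = (\<chi> i. max (x $ i) 0 / max 1 (\<Sum>j\<in>UNIV. max (x $ j) 0))"

definition beta :: "real ^ 'n \<Rightarrow> real ^ 'n \<Rightarrow> 'n \<Rightarrow> real" where
  "beta \<mu>s \<mu>g i = exp (\<mu>g $ i - \<mu>s $ i)"

definition exchange :: "real ^ 'n \<Rightarrow> real ^ 'n \<Rightarrow> real ^ 'n \<Rightarrow> real ^ 'n \<Rightarrow> real ^ 'n" where
  "exchange \<mu>s \<mu>g a b =
     (\<chi> i. sqrt (beta \<mu>s \<mu>g i) * b $ i - 1 / sqrt (beta \<mu>s \<mu>g i) * a $ i)"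

definition F :: "real ^ 'n \<Rightarrow> real ^ 'n \<Rightarrow> nat \<Rightarrow> (nat \<Rightarrow> real ^ 'n) \<Rightarrow> real ^ 'n" where
  "F \<mu>s \<mu>g k c = exchange \<mu>s \<mu>g (c k) (c (k + 1))"

definition F_tilde :: "real ^ 'n \<Rightarrow> real ^ 'n \<Rightarrow> nat \<Rightarrow> (nat \<Rightarrow> real ^ 'n) \<Rightarrow> real ^ 'n" where
  "F_tilde \<mu>s \<mu>g k c = exchange \<mu>s \<mu>g (diamond (c k)) (diamond (c (k + 1)))"

definition J_solid :: "real ^ 'n \<Rightarrow> real ^ 'n \<Rightarrow> nat \<Rightarrow> (nat \<Rightarrow> real ^ 'n) \<Rightarrow> real ^ 'n" where
  "J_solid \<mu>s \<mu>g k c = - ((\<Sum>j\<in>UNIV. c k $ j) *\<^sub>R F_tilde \<mu>s \<mu>g k c)"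

definition J_gas :: "real ^ 'n \<Rightarrow> real ^ 'n \<Rightarrow> nat \<Rightarrow> (nat \<Rightarrow> real ^ 'n) \<Rightarrow> real ^ 'n" where
  "J_gas \<mu>s \<mu>g k c = - ((\<Sum>j\<in>UNIV. c (k + 1) $ j) *\<^sub>R F_tilde \<mu>s \<mu>g k c)"

definition C_bound :: "real ^ 'n \<Rightarrow> real ^ 'n \<Rightarrow> real" where
  "C_bound \<mu>s \<mu>g = Max (range (\<lambda>i. 2 * cosh ((\<mu>g $ i - \<mu>s $ i) / 2)))"


subsection \<open>The schemes\<close>

text \<open>
  \<open>J_left K\<close> and \<open>J_right K\<close> are the fluxes at the two edges of the cell \<open>K\<close>. They are kept apart
  because the modified scheme uses two different fluxes on the two sides of the interface.
\<close>

definition conservation_laws ::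
  "nat \<Rightarrow> real \<Rightarrow> (nat \<Rightarrow> real ^ 'n) \<Rightarrow> real \<Rightarrow> (nat \<Rightarrow> real ^ 'n) \<Rightarrow> real \<Rightarrow>
   (nat \<Rightarrow> real ^ 'n) \<Rightarrow> (nat \<Rightarrow> real ^ 'n) \<Rightarrow> bool" where
  "conservation_laws N dt c_old X_old c X J_left J_right \<longleftrightarrow>
     (\<forall>i. \<forall>K\<in>{1..N}.
        1 / dt * (star_cell_size N X_old X K * c K $ i - cell_size N X_old K * c_old K $ i)
          + J_right K $ i - J_left K $ i = 0)"

text \<open>All flux relations away from the interface edge \<open>k + 1/2\<close>, on which \<open>J k\<close> is left free.\<close>

definition bulk_fluxes ::
  "('n::finite \<Rightarrow> 'n \<Rightarrow> real) \<Rightarrow> ('n \<Rightarrow> 'n \<Rightarrow> real) \<Rightarrow> nat \<Rightarrow> nat \<Rightarrow>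
   (nat \<Rightarrow> real ^ 'n) \<Rightarrow> (nat \<Rightarrow> real ^ 'n) \<Rightarrow> bool" where
  "bulk_fluxes \<kappa>s \<kappa>g N k c J \<longleftrightarrow>
     J 0 = 0 \<and> J N = 0 \<and>
     (\<forall>K. 1 \<le> K \<and> K < k \<longrightarrow> dx N *\<^sub>R J K = - (A_reg \<kappa>s (edge_value c K) *v jump c K)) \<and>
     (\<forall>K. k < K \<and> K \<le> N - 1 \<longrightarrow> dx N *\<^sub>R (A_reg \<kappa>g (edge_value c K) *v J K) = - jump c K)"

definition scheme ::
  "('n::finite \<Rightarrow> 'n \<Rightarrow> real) \<Rightarrow> ('n \<Rightarrow> 'n \<Rightarrow> real) \<Rightarrow> real ^ 'n \<Rightarrow> real ^ 'n \<Rightarrow> nat \<Rightarrow> real \<Rightarrow>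
   (nat \<Rightarrow> real ^ 'n) \<Rightarrow> real \<Rightarrow> (nat \<Rightarrow> real ^ 'n) \<Rightarrow> real \<Rightarrow> (nat \<Rightarrow> real ^ 'n) \<Rightarrow> bool" where
  "scheme \<kappa>s \<kappa>g \<mu>s \<mu>g N dt c_old X_old c X J \<longleftrightarrow>
     (let k = interface_index N X_old in
        X \<in> {0..1} \<and>
        conservation_laws N dt c_old X_old c X (\<lambda>K. J (K - 1)) J \<and>
        bulk_fluxes \<kappa>s \<kappa>g N k c J \<and>
        J k = - F \<mu>s \<mu>g k c \<and>
        X = X_old + dt * (\<Sum>i\<in>UNIV. F \<mu>s \<mu>g k c $ i))"

definition modified_scheme ::
  "('n::finite \<Rightarrow> 'n \<Rightarrow> real) \<Rightarrow> ('n \<Rightarrow> 'n \<Rightarrow> real) \<Rightarrow> real ^ 'n \<Rightarrow> real ^ 'n \<Rightarrow> nat \<Rightarrow> real \<Rightarrow>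
   (nat \<Rightarrow> real ^ 'n) \<Rightarrow> real \<Rightarrow> (nat \<Rightarrow> real ^ 'n) \<Rightarrow> real \<Rightarrow> (nat \<Rightarrow> real ^ 'n) \<Rightarrow> bool" where
  "modified_scheme \<kappa>s \<kappa>g \<mu>s \<mu>g N dt c_old X_old c X J \<longleftrightarrow>
     (let k = interface_index N X_old in
        X \<in> {0..1} \<and>
        conservation_laws N dt c_old X_old c X
          (\<lambda>K. if K = k + 1 then J_gas \<mu>s \<mu>g k c else J (K - 1))
          (\<lambda>K. if K = k then J_solid \<mu>s \<mu>g k c else J K) \<and>
        bulk_fluxes \<kappa>s \<kappa>g N k c J \<and>
        X = X_old + dt * (\<Sum>i\<in>UNIV. F_tilde \<mu>s \<mu>g k c $ i))"

definition post_processing ::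
  "nat \<Rightarrow> real \<Rightarrow> (nat \<Rightarrow> real ^ 'n) \<Rightarrow> real \<Rightarrow> (nat \<Rightarrow> real ^ 'n) \<Rightarrow> bool" where
  "post_processing N X_old c_star X c \<longleftrightarrow>
     (let k = interface_index N X_old; k' = interface_index N X; \<Delta> = star_cell_size N X_old X in
        (k' = k \<longrightarrow> (\<forall>K\<in>{1..N}. c K = c_star K)) \<and>
        (k' = k + 1 \<and> k' < N \<longrightarrow>
           c k = c_star k \<and> c (k + 1) = c_star k \<and>
           c (k' + 1) = (1 / (dx N + \<Delta> k')) *\<^sub>R (\<Delta> k' *\<^sub>R c_star k' + dx N *\<^sub>R c_star (k' + 1)) \<and>
           (\<forall>K\<in>{1..N} - {k, k + 1, k' + 1}. c K = c_star K)) \<and>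
        (k' + 1 = k \<and> 1 < k' \<longrightarrow>
           c k = c_star (k + 1) \<and> c (k + 1) = c_star (k + 1) \<and>
           c (k - 1) = (1 / (dx N + \<Delta> k)) *\<^sub>R (dx N *\<^sub>R c_star (k - 1) + \<Delta> k *\<^sub>R c_star k) \<and>
           (\<forall>K\<in>{1..N} - {k, k + 1, k - 1}. c K = c_star K)))"

text \<open>
  \<open>(c, X)\<close> is a solution, obtained from the intermediate values \<open>c_star\<close> and the fluxes \<open>J\<close>.
\<close>

definition solution ::
  "('n::finite \<Rightarrow> 'n \<Rightarrow> real) \<Rightarrow> ('n \<Rightarrow> 'n \<Rightarrow> real) \<Rightarrow> real ^ 'n \<Rightarrow> real ^ 'n \<Rightarrow> nat \<Rightarrow> real \<Rightarrow>
   (nat \<Rightarrow> real ^ 'n) \<Rightarrow> real \<Rightarrow> (nat \<Rightarrow> real ^ 'n) \<Rightarrow> (nat \<Rightarrow> real ^ 'n) \<Rightarrow>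
   (nat \<Rightarrow> real ^ 'n) \<Rightarrow> real \<Rightarrow> bool" where
  "solution \<kappa>s \<kappa>g \<mu>s \<mu>g N dt c_old X_old c_star J c X \<longleftrightarrow>
     scheme \<kappa>s \<kappa>g \<mu>s \<mu>g N dt c_old X_old c_star X J \<and>
     post_processing N X_old c_star X c \<and>
     1 < interface_index N X \<and> interface_index N X < N"

definition modified_solution ::
  "('n::finite \<Rightarrow> 'n \<Rightarrow> real) \<Rightarrow> ('n \<Rightarrow> 'n \<Rightarrow> real) \<Rightarrow> real ^ 'n \<Rightarrow> real ^ 'n \<Rightarrow> nat \<Rightarrow> real \<Rightarrow>
   (nat \<Rightarrow> real ^ 'n) \<Rightarrow> real \<Rightarrow> (nat \<Rightarrow> real ^ 'n) \<Rightarrow> (nat \<Rightarrow> real ^ 'n) \<Rightarrow>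
   (nat \<Rightarrow> real ^ 'n) \<Rightarrow> real \<Rightarrow> bool" where
  "modified_solution \<kappa>s \<kappa>g \<mu>s \<mu>g N dt c_old X_old c_star J c X \<longleftrightarrow>
     modified_scheme \<kappa>s \<kappa>g \<mu>s \<mu>g N dt c_old X_old c_star X J \<and>
     post_processing N X_old c_star X c \<and>
     1 < interface_index N X \<and> interface_index N X < N"

end

theory Submission
  imports Defs
begin

text \<open>
  All statements follow once the intermediate values \<open>c_star\<close> are known to be nonnegative with total
  \<open>1\<close> in each cell. Both facts come from the same minimum principle
  (\<open>discrete_minimum_principle\<close>): in a cell where a negative minimum is attained, the fluxes point
  inwards, and the balance of the cell cannot hold.

  The truncated interface values are nonnegative with total at most \<open>1\<close>, so that the
  time step bounds the motion of the interface by half a cell. Hence all old and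
  intermediate cell sizes are positive, and the interface index changes by at most one.

  The total of a cell: the columns of \<open>A_reg \<kappa> u\<close> sum to \<open>kappa_min \<kappa>\<close>, so the total solves a
  scalar discrete heat equation in each phase. At the interface the modified fluxes carry the factor
  \<open>\<Sum>\<^sub>j c\<^sub>j\<close> of the adjacent cell, which is exactly the amount by which the displacement of the
  interface changes that cell. What remains is an equation for \<open>total - 1\<close> with the old cell sizes,
  zero data and no flux through the interface. The minimum principle for \<open>total - 1\<close> and for
  \<open>1 - total\<close> shows that the total is \<open>1\<close>.

  The sign of a species: where its value is negative, the edge values of that species vanish by
  definition of the logarithmic mean, and its row of \<open>A_reg \<kappa> u\<close> is a positive multiple of
  the unit row. So its bulk flux near such a cell is driven by its own jump only, also in the gas,
  where the flux is given implicitly. At the interface the truncation removes the outgoing part of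
  the exchange term. Again there is no negative minimum.

  It follows that the truncation acts as the identity, so the two interface fluxes agree with each
  other and with the flux of the unmodified scheme. The post-processing only splits one cell and
  averages two others, with the cell sizes as weights. The Stefan--Maxwell matrices are invertible
  because for nonnegative \<open>u\<close> they are strictly diagonally dominant by columns.
\<close>

section \<open>Cross-diffusion matrices\<close>

lemma kappa_min_attained:
  fixes \<kappa> :: "'n::finite \<Rightarrow> 'n \<Rightarrow> real"
  assumes "CARD('n) \<ge> 2"
  obtains i j where "i \<noteq> j" "kappa_min \<kappa> = \<kappa> i j"
proof -
  let ?S = "{\<kappa> i j |i j. i \<noteq> j}"
  have "?S \<subseteq> range (\<lambda>(i, j). \<kappa> i j)" by auto
  then have "finite ?S" by (rule finite_subset) simp
  moreover obtain i j :: 'n where "i \<noteq> j"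
    using assms card_2_iff' ex_card[of 2 "UNIV :: 'n set"] by metis
  then have "?S \<noteq> {}" by blast
  ultimately have "kappa_min \<kappa> \<in> ?S" unfolding kappa_min_def by (rule Min_in)
  then show thesis using that by blast
qed

lemma kappa_bar_nonneg:
  fixes \<kappa> :: "'n::finite \<Rightarrow> 'n \<Rightarrow> real"
  assumes "i \<noteq> j"
  shows "0 \<le> kappa_bar \<kappa> i j"
proof -
  let ?S = "{\<kappa> i j |i j. i \<noteq> j}"
  have "?S \<subseteq> range (\<lambda>(i, j). \<kappa> i j)" by auto
  then have "finite ?S" by (rule finite_subset) simp
  then have "kappa_min \<kappa> \<le> \<kappa> i j" unfolding kappa_min_def using assms by (intro Min_le) auto
  then show ?thesis by (simp add: kappa_bar_def)
qed

text \<open>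
  The form in which both uses of the matrix can be read off: for symmetric \<open>\<kappa>\<close> the summand is
  antisymmetric in \<open>i\<close> and \<open>l\<close>, and its part that does not contain \<open>x $ i\<close> carries the factor
  \<open>u $ i\<close>. The term \<open>l = i\<close> vanishes, so the sum may run over all species.
\<close>

lemma A_reg_mult_component:
  "(A_reg \<kappa> u *v x) $ i =
     kappa_min \<kappa> * x $ i + (\<Sum>l\<in>UNIV. kappa_bar \<kappa> i l * (u $ l * x $ i - u $ i * x $ l))"
proof -
  have "(A_bar \<kappa> u *v x) $ i = (\<Sum>j\<in>UNIV. A_bar \<kappa> u $ i $ j * x $ j)"
    by (simp add: matrix_vector_mult_def)
  also have "\<dots> = A_bar \<kappa> u $ i $ i * x $ i + (\<Sum>j\<in>UNIV - {i}. A_bar \<kappa> u $ i $ j * x $ j)"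
    by (rule sum.remove) auto
  also have "(\<Sum>j\<in>UNIV - {i}. A_bar \<kappa> u $ i $ j * x $ j)
      = (\<Sum>j\<in>UNIV - {i}. - (kappa_bar \<kappa> i j * u $ i * x $ j))"
    by (rule sum.cong) (auto simp: A_bar_def)
  also have "A_bar \<kappa> u $ i $ i * x $ i = (\<Sum>j\<in>UNIV - {i}. kappa_bar \<kappa> i j * u $ j * x $ i)"
    by (simp add: A_bar_def sum_distrib_right)
  also have "(\<Sum>j\<in>UNIV - {i}. kappa_bar \<kappa> i j * u $ j * x $ i)
        + (\<Sum>j\<in>UNIV - {i}. - (kappa_bar \<kappa> i j * u $ i * x $ j))
      = (\<Sum>l\<in>UNIV - {i}. kappa_bar \<kappa> i l * (u $ l * x $ i - u $ i * x $ l))"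
    by (simp add: sum.distrib[symmetric] algebra_simps)
  also have "\<dots> = (\<Sum>l\<in>UNIV. kappa_bar \<kappa> i l * (u $ l * x $ i - u $ i * x $ l))"
    by (subst (2) sum.remove[of _ i]) auto
  finally show ?thesis
    by (simp add: A_reg_def matrix_vector_mult_add_rdistrib scaleR_matrix_vector_assoc[symmetric])
qed

lemma sum_A_reg_mult:
  assumes "\<And>i j. i \<noteq> j \<Longrightarrow> \<kappa> i j = \<kappa> j i"
  shows "(\<Sum>i\<in>UNIV. (A_reg \<kappa> u *v x) $ i) = kappa_min \<kappa> * (\<Sum>i\<in>UNIV. x $ i)"
proof -
  let ?g = "\<lambda>i l. kappa_bar \<kappa> i l * (u $ l * x $ i - u $ i * x $ l)"
  have "?g i l = - ?g l i" for i l
    using assms[of i l] by (cases "i = l") (auto simp: kappa_bar_def algebra_simps)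
  then have "(\<Sum>i\<in>UNIV. \<Sum>l\<in>UNIV. ?g i l) = (\<Sum>i\<in>UNIV. \<Sum>l\<in>UNIV. - ?g l i)"
    by (intro sum.cong refl)
  also have "\<dots> = - (\<Sum>i\<in>UNIV. \<Sum>l\<in>UNIV. ?g l i)"
    by (simp only: sum_negf)
  also have "\<dots> = - (\<Sum>i\<in>UNIV. \<Sum>l\<in>UNIV. ?g i l)"
    by (subst sum.swap) simp
  finally have "(\<Sum>i\<in>UNIV. \<Sum>l\<in>UNIV. ?g i l) = 0" by simp
  then show ?thesis
    by (simp add: A_reg_mult_component sum.distrib sum_distrib_left)
qed

text \<open>
  The off-diagonal entries of row \<open>i\<close> carry the factor \<open>u $ i\<close>, so an absent species does not feel
  the jumps or the fluxes of the others.
\<close>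

lemma A_reg_mult_absent_species:
  fixes u :: "real ^ 'n"
  assumes "kappa_min \<kappa> > 0" "\<And>l. 0 \<le> u $ l" "u $ i = 0"
  obtains d where "d > 0" "\<And>x. (A_reg \<kappa> u *v x) $ i = d * x $ i"
proof
  let ?d = "kappa_min \<kappa> + (\<Sum>l\<in>UNIV. kappa_bar \<kappa> i l * u $ l)"
  have "0 \<le> kappa_bar \<kappa> i l * u $ l" for l
    using assms(2)[of l] assms(3) kappa_bar_nonneg[of i l \<kappa>] by (cases "l = i") auto
  then have "0 \<le> (\<Sum>l\<in>UNIV. kappa_bar \<kappa> i l * u $ l)" by (simp add: sum_nonneg)
  then show "?d > 0" using assms(1) by simp
  show "(A_reg \<kappa> u *v x) $ i = ?d * x $ i" for x
    by (simp add: A_reg_mult_component assms(3) distrib_right sum_distrib_right mult.assoc)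
qed

text \<open>
  A kernel vector \<open>y\<close> of the transpose can have neither a positive maximum nor a negative minimum:
  at an extremal index the off-diagonal part, a combination of the differences \<open>y $ j - y $ i\<close> with
  nonnegative coefficients, has the sign of the diagonal part \<open>kappa_min \<kappa> * y $ j\<close>.
\<close>

lemma invertible_A_reg:
  fixes u :: "real ^ 'n"
  assumes sym: "\<And>i j. i \<noteq> j \<Longrightarrow> \<kappa> i j = \<kappa> j i"
    and pos: "kappa_min \<kappa> > 0" and u: "\<And>l. 0 \<le> u $ l"
  shows "invertible (A_reg \<kappa> u)"
proof -
  have component: "(transpose (A_reg \<kappa> u) *v y) $ j
      = kappa_min \<kappa> * y $ j + (\<Sum>i\<in>UNIV - {j}. kappa_bar \<kappa> i j * u $ i * (y $ j - y $ i))"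
    for y :: "real ^ 'n" and j
  proof -
    have "(transpose (A_reg \<kappa> u) *v y) $ j = (\<Sum>i\<in>UNIV. A_reg \<kappa> u $ i $ j * y $ i)"
      by (simp add: matrix_vector_mult_def transpose_def)
    also have "\<dots> = A_reg \<kappa> u $ j $ j * y $ j + (\<Sum>i\<in>UNIV - {j}. A_reg \<kappa> u $ i $ j * y $ i)"
      by (rule sum.remove) auto
    also have "(\<Sum>i\<in>UNIV - {j}. A_reg \<kappa> u $ i $ j * y $ i)
        = (\<Sum>i\<in>UNIV - {j}. - (kappa_bar \<kappa> i j * u $ i * y $ i))"
      by (rule sum.cong) (auto simp: A_reg_def A_bar_def mat_def)
    also have "A_reg \<kappa> u $ j $ j * y $ j
        = kappa_min \<kappa> * y $ j + (\<Sum>i\<in>UNIV - {j}. kappa_bar \<kappa> j i * u $ i * y $ j)"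
      by (simp add: A_reg_def A_bar_def mat_def sum_distrib_right distrib_right)
    also have "(\<Sum>i\<in>UNIV - {j}. kappa_bar \<kappa> j i * u $ i * y $ j)
        = (\<Sum>i\<in>UNIV - {j}. kappa_bar \<kappa> i j * u $ i * y $ j)"
      using sym[of j] by (intro sum.cong) (auto simp: kappa_bar_def)
    finally show ?thesis
      by (simp add: right_diff_distrib sum_subtractf sum_negf)
  qed
  have kernel_le: "y $ l \<le> 0" if "transpose (A_reg \<kappa> u) *v y = 0" for y :: "real ^ 'n" and l
  proof -
    have "Max (range (($) y)) \<in> range (($) y)" by (rule Max_in) auto
    then obtain j where "y $ j = Max (range (($) y))" by (metis imageE)
    then have j: "y $ i \<le> y $ j" for i by (simp add: Max_ge)
    have "0 \<le> (\<Sum>i\<in>UNIV - {j}. kappa_bar \<kappa> i j * u $ i * (y $ j - y $ i))"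
      using j u by (intro sum_nonneg mult_nonneg_nonneg kappa_bar_nonneg) auto
    moreover have "(transpose (A_reg \<kappa> u) *v y) $ j = 0" using that by simp
    ultimately have "kappa_min \<kappa> * y $ j \<le> 0" unfolding component by linarith
    then show ?thesis using pos j[of l] by (simp add: mult_le_0_iff)
  qed
  have "y = 0" if "transpose (A_reg \<kappa> u) *v y = 0" for y
  proof -
    have "transpose (A_reg \<kappa> u) *v (- y) = 0"
      using that by (simp add: vec.neg)
    then show ?thesis
      using kernel_le[OF that] kernel_le[of "- y"] by (simp add: vec_eq_iff order_antisym)
  qed
  then have "\<exists>B. B ** transpose (A_reg \<kappa> u) = mat 1" by (simp add: matrix_left_invertible_ker)
  then have "invertible (transpose (A_reg \<kappa> u))" by (simp add: invertible_left_inverse)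
  then show ?thesis using transpose_invertible by fastforce
qed


section \<open>Edge values, truncation and interface speed\<close>

lemma log_mean_nonneg: "0 \<le> log_mean a b"
  by (auto simp: log_mean_def zero_le_divide_iff)

lemma edge_value_nonneg: "0 \<le> edge_value c K $ i"
  by (simp add: edge_value_def log_mean_nonneg)

lemma edge_value_eq_0:
  "c K $ i \<le> 0 \<Longrightarrow> edge_value c K $ i = 0"
  "c (K + 1) $ i \<le> 0 \<Longrightarrow> edge_value c K $ i = 0"
  by (auto simp: edge_value_def log_mean_def)

lemma diamond_nonneg: "0 \<le> diamond x $ i"
  by (simp add: diamond_def)

lemma diamond_nonpos_component: "x $ i \<le> 0 \<Longrightarrow> diamond x $ i = 0"
  by (simp add: diamond_def)

lemma sum_diamond_le_1: "(\<Sum>i\<in>UNIV. diamond x $ i) \<le> 1"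
  by (simp add: diamond_def sum_divide_distrib[symmetric])

lemma diamond_admissible: "x \<in> admissible \<Longrightarrow> diamond x = x"
  by (simp add: admissible_def diamond_def vec_eq_iff max_absorb1)

lemma admissible_convex_combination:
  assumes "x \<in> admissible" "y \<in> admissible" "0 \<le> a" "0 \<le> b" "a + b > 0"
  shows "(1 / (a + b)) *\<^sub>R (a *\<^sub>R x + b *\<^sub>R y) \<in> admissible"
  using assms
  by (simp add: admissible_def sum_divide_distrib[symmetric] sum.distrib sum_distrib_left[symmetric])

lemma sqrt_beta: "sqrt (beta \<mu>s \<mu>g i) = exp ((\<mu>g $ i - \<mu>s $ i) / 2)"
proof -
  have "exp (\<mu>g $ i - \<mu>s $ i) = (exp ((\<mu>g $ i - \<mu>s $ i) / 2))\<^sup>2"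
    by (simp add: exp_double[symmetric])
  then show ?thesis by (simp add: beta_def)
qed

text \<open>
  The two rates are positive and inverse to each other, with sum \<open>2 * cosh ((\<mu>g $ i - \<mu>s $ i) / 2)\<close>.
\<close>

lemma exchange_rates_le_C_bound:
  fixes \<mu>s \<mu>g :: "real ^ 'n"
  shows "sqrt (beta \<mu>s \<mu>g i) \<le> C_bound \<mu>s \<mu>g" "1 / sqrt (beta \<mu>s \<mu>g i) \<le> C_bound \<mu>s \<mu>g"
proof -
  let ?h = "(\<mu>g $ i - \<mu>s $ i) / 2"
  have "2 * cosh ?h \<le> C_bound \<mu>s \<mu>g" unfolding C_bound_def by (rule Max_ge) auto
  moreover have "2 * cosh ?h = exp ?h + 1 / exp ?h"
    by (simp add: cosh_field_def exp_minus inverse_eq_divide)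
  moreover have "exp ?h > 0" "1 / exp ?h > 0" by auto
  ultimately show "sqrt (beta \<mu>s \<mu>g i) \<le> C_bound \<mu>s \<mu>g" "1 / sqrt (beta \<mu>s \<mu>g i) \<le> C_bound \<mu>s \<mu>g"
    unfolding sqrt_beta by linarith+
qed

lemma C_bound_pos: "C_bound \<mu>s \<mu>g > 0"
  using exchange_rates_le_C_bound(1)[of \<mu>s \<mu>g undefined, unfolded sqrt_beta]
  by (rule less_le_trans[OF exp_gt_zero])

text \<open>
  The truncation bounds the interface speed before anything is known about the cell values.
\<close>

lemma abs_sum_F_tilde_le:
  "\<bar>\<Sum>i\<in>UNIV. F_tilde \<mu>s \<mu>g k c $ i\<bar> \<le> C_bound \<mu>s \<mu>g"
proof -
  let ?C = "C_bound \<mu>s \<mu>g" and ?a = "diamond (c k)" and ?b = "diamond (c (k + 1))"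
  have weighted: "0 \<le> (\<Sum>i\<in>UNIV. r i * diamond x $ i) \<and> (\<Sum>i\<in>UNIV. r i * diamond x $ i) \<le> ?C"
    if "\<And>i. 0 \<le> r i" "\<And>i. r i \<le> ?C" for r :: "'a \<Rightarrow> real" and x :: "real ^ 'a"
  proof -
    have "(\<Sum>i\<in>UNIV. r i * diamond x $ i) \<le> (\<Sum>i\<in>UNIV. ?C * diamond x $ i)"
      using that by (intro sum_mono mult_right_mono diamond_nonneg)
    also have "\<dots> \<le> ?C * 1"
      unfolding sum_distrib_left[symmetric] using C_bound_pos sum_diamond_le_1
      by (intro mult_left_mono) (auto intro: less_imp_le)
    finally show ?thesis using that by (auto intro!: sum_nonneg mult_nonneg_nonneg diamond_nonneg)
  qed
  have "0 \<le> (\<Sum>i\<in>UNIV. sqrt (beta \<mu>s \<mu>g i) * ?b $ i)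
      \<and> (\<Sum>i\<in>UNIV. sqrt (beta \<mu>s \<mu>g i) * ?b $ i) \<le> ?C"
    by (rule weighted) (simp_all add: beta_def exchange_rates_le_C_bound[unfolded beta_def])
  moreover have "0 \<le> (\<Sum>i\<in>UNIV. 1 / sqrt (beta \<mu>s \<mu>g i) * ?a $ i)
      \<and> (\<Sum>i\<in>UNIV. 1 / sqrt (beta \<mu>s \<mu>g i) * ?a $ i) \<le> ?C"
    by (rule weighted) (simp_all add: beta_def exchange_rates_le_C_bound[unfolded beta_def])
  moreover have "(\<Sum>i\<in>UNIV. F_tilde \<mu>s \<mu>g k c $ i)
      = (\<Sum>i\<in>UNIV. sqrt (beta \<mu>s \<mu>g i) * ?b $ i) - (\<Sum>i\<in>UNIV. 1 / sqrt (beta \<mu>s \<mu>g i) * ?a $ i)"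
    by (simp add: F_tilde_def exchange_def sum_subtractf)
  ultimately show ?thesis by linarith
qed

lemma F_tilde_nonneg_if_absent_solid:
  "c k $ i \<le> 0 \<Longrightarrow> 0 \<le> F_tilde \<mu>s \<mu>g k c $ i"
  by (simp add: F_tilde_def exchange_def diamond_nonpos_component diamond_nonneg beta_def)

lemma F_tilde_nonpos_if_absent_gas:
  "c (k + 1) $ i \<le> 0 \<Longrightarrow> F_tilde \<mu>s \<mu>g k c $ i \<le> 0"
  by (simp add: F_tilde_def exchange_def diamond_nonpos_component diamond_nonneg beta_def)


section \<open>Mesh\<close>

lemma edge_Suc: "edge N (K + 1) = edge N K + dx N"
  by (simp add: edge_def distrib_right)

lemma interface_index_minimizes:
  assumes "K \<le> N"
  shows "\<bar>edge N (interface_index N X) - X\<bar> \<le> \<bar>edge N K - X\<bar>"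
proof -
  let ?P = "is_arg_min (\<lambda>K. \<bar>edge N K - X\<bar>) (\<lambda>K. K \<le> N)"
  have "\<exists>K. ?P K"
    using ex_is_arg_min_if_finite[of "{..N}" "\<lambda>K. \<bar>edge N K - X\<bar>"] by simp
  then have "?P (interface_index N X)" unfolding interface_index_def by (rule LeastI_ex)
  then show ?thesis using assms by (auto simp: is_arg_min_linorder)
qed

lemma interface_near_edge:
  assumes "0 < interface_index N X" "interface_index N X < N"
  shows "\<bar>edge N (interface_index N X) - X\<bar> \<le> dx N / 2"
proof -
  let ?k = "interface_index N X"
  have "dx N > 0" using assms by (simp add: dx_def)
  moreover have "\<bar>edge N ?k - X\<bar> \<le> \<bar>edge N ?k + dx N - X\<bar>"
    using interface_index_minimizes[of "?k + 1" N X] assms by (simp add: edge_Suc[symmetric])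
  moreover have "\<bar>edge N ?k - X\<bar> \<le> \<bar>edge N ?k - dx N - X\<bar>"
    using interface_index_minimizes[of "?k - 1" N X] edge_Suc[of N "?k - 1"] assms by simp
  ultimately show ?thesis by linarith
qed


section \<open>A discrete minimum principle\<close>

text \<open>
  At a cell where \<open>a\<close> is minimal and negative, both fluxes point inwards, which the balance forbids.
  The two functions \<open>j_right K\<close> and \<open>j_left (K + 1)\<close> are not assumed to agree, because the modified
  scheme has two fluxes at the interface edge.
\<close>

lemma discrete_minimum_principle:
  fixes a w j_left j_right :: "nat \<Rightarrow> real"
  assumes w: "\<And>K. K \<in> {1..N} \<Longrightarrow> 0 < w K" and "0 \<le> t"
    and balance: "\<And>K. K \<in> {1..N} \<Longrightarrow> 0 \<le> w K * a K + t * (j_right K - j_left K)"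
    and right: "\<And>K. K \<in> {1..N} \<Longrightarrow> a K < 0 \<Longrightarrow> (K < N \<Longrightarrow> a K \<le> a (K + 1)) \<Longrightarrow> j_right K \<le> 0"
    and left: "\<And>K. K \<in> {1..N} \<Longrightarrow> a K < 0 \<Longrightarrow> (1 < K \<Longrightarrow> a K \<le> a (K - 1)) \<Longrightarrow> 0 \<le> j_left K"
    and "K \<in> {1..N}"
  shows "0 \<le> a K"
proof (rule ccontr)
  assume "\<not> 0 \<le> a K"
  obtain M where M: "M \<in> {1..N}" "\<And>L. L \<in> {1..N} \<Longrightarrow> a M \<le> a L"
    using ex_is_arg_min_if_finite[of "{1..N}" a] assms(6) by (auto simp: is_arg_min_linorder)
  then have "a M < 0" using \<open>\<not> 0 \<le> a K\<close> assms(6) by (meson le_less_trans not_le)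
  have "j_right M \<le> 0" by (rule right[OF M(1) \<open>a M < 0\<close>]) (use M in auto)
  moreover have "a M \<le> a (M - 1)" if "1 < M"
    using M that by (intro M(2)) auto
  then have "0 \<le> j_left M" by (rule left[OF M(1) \<open>a M < 0\<close>])
  ultimately have "t * (j_right M - j_left M) \<le> 0"
    using \<open>0 \<le> t\<close> by (intro mult_nonneg_nonpos) auto
  moreover have "w M * a M < 0" using w[OF M(1)] \<open>a M < 0\<close> by (rule mult_pos_neg)
  ultimately show False using balance[OF M(1)] by linarith
qed


section \<open>One step of the modified scheme\<close>

locale modified_step =
  fixes \<kappa>s \<kappa>g :: "'n::finite \<Rightarrow> 'n \<Rightarrow> real"
    and \<mu>s \<mu>g :: "real ^ 'n"
    and N k :: nat
    and dt X_old X :: real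
    and c_old c J :: "nat \<Rightarrow> real ^ 'n"
  assumes two_species: "CARD('n) \<ge> 2"
    and \<kappa>s: "\<And>i j. i \<noteq> j \<Longrightarrow> \<kappa>s i j = \<kappa>s j i \<and> \<kappa>s i j > 0"
    and \<kappa>g: "\<And>i j. i \<noteq> j \<Longrightarrow> \<kappa>g i j = \<kappa>g j i \<and> \<kappa>g i j > 0"
    and dt_pos: "0 < dt" and dt_small: "dt < dx N / (2 * C_bound \<mu>s \<mu>g)"
    and c_old: "\<And>K. K \<in> {1..N} \<Longrightarrow> c_old K \<in> admissible"
    and k: "k = interface_index N X_old" "1 < k" "k < N"
    and step: "modified_scheme \<kappa>s \<kappa>g \<mu>s \<mu>g N dt c_old X_old c X J"
begin

abbreviation "J_left \<equiv> \<lambda>K. if K = k + 1 then J_gas \<mu>s \<mu>g k c else J (K - 1)"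
abbreviation "J_right \<equiv> \<lambda>K. if K = k then J_solid \<mu>s \<mu>g k c else J K"
abbreviation species_sum :: "real ^ 'n \<Rightarrow> real" where
  "species_sum x \<equiv> \<Sum>i\<in>UNIV. x $ i"

lemma kappa_min_pos: "kappa_min \<kappa>s > 0" "kappa_min \<kappa>g > 0"
  using kappa_min_attained[OF two_species] \<kappa>s \<kappa>g by metis+

lemma dx_pos: "dx N > 0"
  using k by (simp add: dx_def)

lemma displacement: "X - X_old = dt * species_sum (F_tilde \<mu>s \<mu>g k c)"
  using step by (simp add: modified_scheme_def Let_def k(1)[symmetric])

lemma balance:
  assumes "K \<in> {1..N}"
  shows "star_cell_size N X_old X K * c K $ i - cell_size N X_old K * c_old K $ i
    + dt * (J_right K $ i - J_left K $ i) = 0"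
proof -
  have "1 / dt * (star_cell_size N X_old X K * c K $ i - cell_size N X_old K * c_old K $ i)
      + J_right K $ i - J_left K $ i = 0"
    using step assms unfolding modified_scheme_def conservation_laws_def Let_def k(1) by blast
  then show ?thesis using dt_pos by (simp add: field_simps)
qed

lemma boundary_fluxes: "J 0 = 0" "J N = 0"
  using step by (simp_all add: modified_scheme_def bulk_fluxes_def Let_def)

lemma solid_flux:
  "1 \<le> K \<Longrightarrow> K < k \<Longrightarrow> dx N *\<^sub>R J K = - (A_reg \<kappa>s (edge_value c K) *v jump c K)"
  using step by (simp add: modified_scheme_def bulk_fluxes_def Let_def k(1)[symmetric])

lemma gas_flux:
  "k < K \<Longrightarrow> K < N \<Longrightarrow> dx N *\<^sub>R (A_reg \<kappa>g (edge_value c K) *v J K) = - jump c K"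
  using step by (simp add: modified_scheme_def bulk_fluxes_def Let_def k(1)[symmetric])

lemma displacement_small: "\<bar>X - X_old\<bar> < dx N / 2"
proof -
  have "\<bar>X - X_old\<bar> = dt * \<bar>species_sum (F_tilde \<mu>s \<mu>g k c)\<bar>"
    using dt_pos by (simp add: displacement abs_mult)
  also have "\<dots> \<le> dt * C_bound \<mu>s \<mu>g"
    using dt_pos abs_sum_F_tilde_le by (intro mult_left_mono) auto
  also have "\<dots> < dx N / 2"
    using dt_small C_bound_pos[of \<mu>s \<mu>g] by (simp add: field_simps)
  finally show ?thesis .
qed

lemma old_interface_near_edge: "\<bar>edge N k - X_old\<bar> \<le> dx N / 2"
  using interface_near_edge[of N X_old] k by simp

lemma edge_before_k: "edge N (k - 1) = edge N k - dx N"
  using edge_Suc[of N "k - 1"] k by simp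

lemma cell_size_pos: "cell_size N X_old K > 0"
proof -
  have "X_old - (edge N k - dx N) > 0" "edge N k + dx N - X_old > 0"
    using old_interface_near_edge dx_pos by linarith+
  then show ?thesis
    unfolding cell_size_def moved_cell_size_def k(1)[symmetric] edge_before_k edge_Suc
    using dx_pos by simp
qed

lemma star_cell_size_pos: "star_cell_size N X_old X K > 0"
proof -
  have "X - (edge N k - dx N) > 0" "edge N k + dx N - X > 0"
    using old_interface_near_edge displacement_small by linarith+
  then show ?thesis
    unfolding star_cell_size_def moved_cell_size_def k(1)[symmetric] edge_before_k edge_Suc
    using dx_pos by simp
qed


subsection \<open>Volume filling\<close>

text \<open>
  Summation over the species removes the cross terms. In the gas, where the flux is given implicitly,
  it is applied to the linear system, so the factor is the inverse of the one in the solid.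
\<close>

lemma total_bulk_flux:
  assumes "1 \<le> K" "K < N" "K \<noteq> k"
  obtains d where "d > 0" "species_sum (J K) = - d * (species_sum (c (K + 1)) - species_sum (c K))"
proof -
  have jump: "species_sum (jump c K) = species_sum (c (K + 1)) - species_sum (c K)"
    by (simp add: jump_def sum_subtractf)
  show thesis
  proof (cases "K < k")
    case True
    have "dx N * species_sum (J K) = species_sum (dx N *\<^sub>R J K)" by (simp add: sum_distrib_left)
    also have "\<dots> = - (kappa_min \<kappa>s * species_sum (jump c K))"
      using \<kappa>s sum_A_reg_mult[of \<kappa>s]
      by (simp add: solid_flux[OF assms(1) True] sum_negf)
    finally show thesis
      using that[of "kappa_min \<kappa>s / dx N"] kappa_min_pos dx_pos jump by (simp add: field_simps)
  next
    case False
    then have "k < K" using assms by simp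
    have "dx N * (kappa_min \<kappa>g * species_sum (J K)) = dx N * species_sum (A_reg \<kappa>g (edge_value c K) *v J K)"
      using \<kappa>g sum_A_reg_mult[of \<kappa>g] by simp
    also have "\<dots> = species_sum (dx N *\<^sub>R (A_reg \<kappa>g (edge_value c K) *v J K))"
      by (simp add: sum_distrib_left)
    also have "\<dots> = - species_sum (jump c K)"
      by (simp add: gas_flux[OF \<open>k < K\<close> assms(2)] sum_negf)
    finally show thesis
      using that[of "1 / (dx N * kappa_min \<kappa>g)"] kappa_min_pos dx_pos jump by (simp add: field_simps)
  qed
qed

text \<open>
  The interface fluxes of the modified scheme carry the totals of the cells next to the interface,
  and exactly compensate the change of size of these cells: the totals see a diffusion with the old
  cell sizes and no flux through the interface.
\<close>

lemma total_balance:
  assumes "K \<in> {1..N}"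
  shows "cell_size N X_old K * (species_sum (c K) - 1)
    + dt * ((if K = k then 0 else species_sum (J K)) - (if K = k + 1 then 0 else species_sum (J (K - 1)))) = 0"
proof -
  have "0 = species_sum (\<chi> i. star_cell_size N X_old X K * c K $ i - cell_size N X_old K * c_old K $ i
      + dt * (J_right K $ i - J_left K $ i))"
    by (simp only: balance[OF assms] vec_lambda_beta sum.neutral_const)
  also have "\<dots> = star_cell_size N X_old X K * species_sum (c K) - cell_size N X_old K * species_sum (c_old K)
      + dt * (species_sum (J_right K) - species_sum (J_left K))"
    by (simp only: vec_lambda_beta sum.distrib sum_subtractf sum_distrib_left[symmetric])
  also have "species_sum (c_old K) = 1" using c_old[OF assms] by (simp add: admissible_def)
  finally have balance_total: "star_cell_size N X_old X K * species_sum (c K) - cell_size N X_old K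
      + dt * (species_sum (J_right K) - species_sum (J_left K)) = 0" by simp
  have solid: "dt * species_sum (J_solid \<mu>s \<mu>g k c) = - species_sum (c k) * (X - X_old)"
    by (simp add: J_solid_def displacement sum_negf sum_distrib_left[symmetric])
  have gas: "dt * species_sum (J_gas \<mu>s \<mu>g k c) = - species_sum (c (k + 1)) * (X - X_old)"
    by (simp add: J_gas_def displacement sum_negf sum_distrib_left[symmetric])
  consider "K = k" | "K = k + 1" | "K \<noteq> k" "K \<noteq> k + 1" by blast
  then show ?thesis
  proof cases
    case 1
    then have size: "star_cell_size N X_old X K = cell_size N X_old K + (X - X_old)"
      by (simp add: star_cell_size_def cell_size_def moved_cell_size_def k(1)[symmetric])
    then show ?thesis using balance_total[unfolded size] solid 1 by (simp add: algebra_simps; linarith)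
  next
    case 2
    then have size: "star_cell_size N X_old X K = cell_size N X_old K - (X - X_old)"
      by (simp add: star_cell_size_def cell_size_def moved_cell_size_def k(1)[symmetric])
    then show ?thesis using balance_total[unfolded size] gas 2 by (simp add: algebra_simps; linarith)
  next
    case 3
    then have size: "star_cell_size N X_old X K = cell_size N X_old K"
      by (simp add: star_cell_size_def cell_size_def moved_cell_size_def k(1)[symmetric])
    then show ?thesis using balance_total[unfolded size] 3 by (simp add: algebra_simps)
  qed
qed

lemma total_eq_1:
  assumes "K \<in> {1..N}"
  shows "species_sum (c K) = 1"
proof -
  let ?right = "\<lambda>K. if K = k then 0 else species_sum (J K)"
  let ?left = "\<lambda>K. if K = k + 1 then 0 else species_sum (J (K - 1))"
  have right_zero: "?right K = 0" if "K = k \<or> K = N" for K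
    using that boundary_fluxes by auto
  have left_zero: "?left K = 0" if "K = 1 \<or> K = k + 1" for K
    using that boundary_fluxes by auto
  \<comment> \<open>The equation is linear and homogeneous in \<open>species_sum (c K) - 1\<close>, so both signs can be treated
      at once.\<close>
  have minimum: "0 \<le> s * (species_sum (c K) - 1)" if s: "s = 1 \<or> s = - 1" for s :: real
  proof (rule discrete_minimum_principle[where a = "\<lambda>K. s * (species_sum (c K) - 1)"
        and w = "cell_size N X_old" and t = dt and K = K and N = N
        and j_right = "\<lambda>K. s * ?right K" and j_left = "\<lambda>K. s * ?left K"])
    fix K assume K: "K \<in> {1..N}"
    have "0 = s * (cell_size N X_old K * (species_sum (c K) - 1) + dt * (?right K - ?left K))"
      using total_balance[OF K] by simp
    then show "0 \<le> cell_size N X_old K * (s * (species_sum (c K) - 1)) + dt * (s * ?right K - s * ?left K)"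
      by (simp add: algebra_simps)
  next
    fix K
    assume K: "K \<in> {1..N}"
      and min: "K < N \<Longrightarrow> s * (species_sum (c K) - 1) \<le> s * (species_sum (c (K + 1)) - 1)"
    show "s * ?right K \<le> 0"
    proof (cases "K = k \<or> K = N")
      case True
      then show ?thesis using right_zero by simp
    next
      case False
      then obtain d where "d > 0" "species_sum (J K) = - d * (species_sum (c (K + 1)) - species_sum (c K))"
        using total_bulk_flux[of K] K by auto
      moreover from this have "?right K = - d * (species_sum (c (K + 1)) - species_sum (c K))"
        using False by simp
      ultimately have "s * ?right K = - (d * (s * (species_sum (c (K + 1)) - 1) - s * (species_sum (c K) - 1)))"
        by (simp only:) (simp add: algebra_simps)
      then show ?thesis using min \<open>d > 0\<close> K False by simp
    qed
  next
    fix K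
    assume K: "K \<in> {1..N}"
      and min: "1 < K \<Longrightarrow> s * (species_sum (c K) - 1) \<le> s * (species_sum (c (K - 1)) - 1)"
    show "0 \<le> s * ?left K"
    proof (cases "K = 1 \<or> K = k + 1")
      case True
      then show ?thesis using left_zero by simp
    next
      case False
      then have "1 \<le> K - 1" "K - 1 < N" "K - 1 \<noteq> k" "K - 1 + 1 = K" using K by auto
      then obtain d where "d > 0" "species_sum (J (K - 1)) = - d * (species_sum (c K) - species_sum (c (K - 1)))"
        using total_bulk_flux[of "K - 1"] by metis
      moreover from this have "?left K = - d * (species_sum (c K) - species_sum (c (K - 1)))"
        using False by simp
      ultimately have "s * ?left K = d * (s * (species_sum (c (K - 1)) - 1) - s * (species_sum (c K) - 1))"
        by (simp only:) (simp add: algebra_simps)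
      then show ?thesis using min \<open>d > 0\<close> K False by simp
    qed
  qed (use assms dt_pos cell_size_pos in auto)
  show ?thesis using minimum[of 1] minimum[of "- 1"] by simp
qed

lemma J_solid_eq: "J_solid \<mu>s \<mu>g k c = - F_tilde \<mu>s \<mu>g k c"
  using total_eq_1[of k] k by (simp add: J_solid_def)

lemma J_gas_eq: "J_gas \<mu>s \<mu>g k c = - F_tilde \<mu>s \<mu>g k c"
  using total_eq_1[of "k + 1"] k by (simp add: J_gas_def)


subsection \<open>Nonnegativity\<close>

text \<open>
  The edge value of a species vanishes as soon as one of the neighbouring values is nonpositive. The
  cross terms then disappear, and the flux is a negative multiple of the jump of that species alone.
\<close>

lemma absent_species_bulk_flux:
  assumes "1 \<le> K" "K < N" "K \<noteq> k" and "c K $ i \<le> 0 \<or> c (K + 1) $ i \<le> 0"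
  obtains d where "d > 0" "J K $ i = - d * (c (K + 1) $ i - c K $ i)"
proof -
  have u: "edge_value c K $ i = 0" using assms(4) edge_value_eq_0 by blast
  have jump: "jump c K $ i = c (K + 1) $ i - c K $ i" by (simp add: jump_def)
  show thesis
  proof (cases "K < k")
    case True
    obtain d where d: "d > 0" "\<And>x. (A_reg \<kappa>s (edge_value c K) *v x) $ i = d * x $ i"
      using A_reg_mult_absent_species[OF kappa_min_pos(1) edge_value_nonneg u] by metis
    have "dx N * J K $ i = (dx N *\<^sub>R J K) $ i" by simp
    also have "\<dots> = - d * jump c K $ i" by (simp add: solid_flux[OF assms(1) True] d(2))
    finally show thesis using that[of "d / dx N"] d dx_pos jump by (simp add: field_simps)
  next
    case False
    then have "k < K" using assms by simp
    obtain d where d: "d > 0" "\<And>x. (A_reg \<kappa>g (edge_value c K) *v x) $ i = d * x $ i"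
      using A_reg_mult_absent_species[OF kappa_min_pos(2) edge_value_nonneg u] by metis
    have "dx N * (d * J K $ i) = (dx N *\<^sub>R (A_reg \<kappa>g (edge_value c K) *v J K)) $ i"
      by (simp add: d(2))
    also have "\<dots> = - jump c K $ i" by (simp add: gas_flux[OF \<open>k < K\<close> assms(2)])
    finally show thesis using that[of "1 / (dx N * d)"] d dx_pos jump by (simp add: field_simps)
  qed
qed

lemma nonneg:
  assumes "K \<in> {1..N}"
  shows "0 \<le> c K $ i"
proof (rule discrete_minimum_principle[where a = "\<lambda>K. c K $ i" and w = "star_cell_size N X_old X"
      and t = dt and K = K and N = N
      and j_right = "\<lambda>K. J_right K $ i" and j_left = "\<lambda>K. J_left K $ i"])
  fix K assume K: "K \<in> {1..N}"
  have "0 \<le> cell_size N X_old K * c_old K $ i"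
    using cell_size_pos[of K] c_old[OF K] by (simp add: admissible_def)
  then show "0 \<le> star_cell_size N X_old X K * c K $ i + dt * (J_right K $ i - J_left K $ i)"
    using balance[OF K, of i] by linarith
next
  fix K assume K: "K \<in> {1..N}" and neg: "c K $ i < 0" and min: "K < N \<Longrightarrow> c K $ i \<le> c (K + 1) $ i"
  consider "K = k" | "K = N" | "1 \<le> K" "K < N" "K \<noteq> k" using K by fastforce
  then show "J_right K $ i \<le> 0"
  proof cases
    case 1
    then show ?thesis
      using neg F_tilde_nonneg_if_absent_solid[of c k i] by (simp add: J_solid_eq)
  next
    case 2
    then show ?thesis using boundary_fluxes k by simp
  next
    case 3
    then obtain d where "d > 0" "J K $ i = - d * (c (K + 1) $ i - c K $ i)"
      using absent_species_bulk_flux[of K i] neg by auto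
    then show ?thesis using 3 min by simp
  qed
next
  fix K assume K: "K \<in> {1..N}" and neg: "c K $ i < 0" and min: "1 < K \<Longrightarrow> c K $ i \<le> c (K - 1) $ i"
  consider "K = k + 1" | "K = 1" | "1 \<le> K - 1" "K - 1 < N" "K - 1 \<noteq> k" "K - 1 + 1 = K" "K \<noteq> k + 1"
    using K by fastforce
  then show "0 \<le> J_left K $ i"
  proof cases
    case 1
    then show ?thesis
      using neg F_tilde_nonpos_if_absent_gas[of c k i] by (simp add: J_gas_eq)
  next
    case 2
    then show ?thesis using boundary_fluxes k by simp
  next
    case 3
    then obtain d where "d > 0" "J (K - 1) $ i = - d * (c K $ i - c (K - 1) $ i)"
      using absent_species_bulk_flux[of "K - 1" i] neg by (metis less_imp_le)
    then show ?thesis using 3 min by (simp add: mult_le_0_iff)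
  qed
qed (use assms dt_pos star_cell_size_pos in auto)

lemma admissible: "K \<in> {1..N} \<Longrightarrow> c K \<in> admissible"
  using nonneg total_eq_1 by (simp add: admissible_def)

lemma diamond_eq: "K \<in> {1..N} \<Longrightarrow> diamond (c K) = c K"
  by (rule diamond_admissible) (rule admissible)

lemma F_tilde_eq: "F_tilde \<mu>s \<mu>g k c = F \<mu>s \<mu>g k c"
  using diamond_eq[of k] diamond_eq[of "k + 1"] k by (simp add: F_tilde_def F_def)

lemma scheme: "scheme \<kappa>s \<kappa>g \<mu>s \<mu>g N dt c_old X_old c X (J(k := J_solid \<mu>s \<mu>g k c))"
proof -
  let ?J = "J(k := J_solid \<mu>s \<mu>g k c)"
  have "conservation_laws N dt c_old X_old c X (\<lambda>K. ?J (K - 1)) ?J"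
    unfolding conservation_laws_def
  proof (intro allI ballI)
    fix i K assume K: "K \<in> {1..N}"
    have "?J (K - 1) = J_left K" "?J K = J_right K" using K by (auto simp: J_solid_eq J_gas_eq)
    then show "1 / dt * (star_cell_size N X_old X K * c K $ i - cell_size N X_old K * c_old K $ i)
        + ?J K $ i - ?J (K - 1) $ i = 0"
      using balance[OF K, of i] dt_pos by (simp add: field_simps)
  qed
  moreover have "bulk_fluxes \<kappa>s \<kappa>g N k c ?J"
    using step k by (simp add: modified_scheme_def bulk_fluxes_def Let_def)
  moreover have "?J k = - F \<mu>s \<mu>g k c" by (simp add: J_solid_eq F_tilde_eq)
  moreover have "X \<in> {0..1} \<and> X = X_old + dt * species_sum (F \<mu>s \<mu>g k c)"
    using step by (simp add: modified_scheme_def Let_def k(1)[symmetric] F_tilde_eq)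
  ultimately show ?thesis unfolding scheme_def Let_def k(1)[symmetric] by blast
qed


subsection \<open>Conservation of mass and post-processing\<close>

lemma star_mass:
  "(\<Sum>K=1..N. star_cell_size N X_old X K * c K $ i) = (\<Sum>K=1..N. cell_size N X_old K * c_old K $ i)"
proof -
  let ?J = "J(k := J_solid \<mu>s \<mu>g k c)"
  have "star_cell_size N X_old X K * c K $ i
      = cell_size N X_old K * c_old K $ i - dt * (?J K $ i - ?J (K - 1) $ i)" if "K \<in> {1..N}" for K
  proof -
    have "?J (K - 1) = J_left K" "?J K = J_right K" using that by (auto simp: J_solid_eq J_gas_eq)
    then show ?thesis using balance[OF that, of i] by simp
  qed
  then have "(\<Sum>K=1..N. star_cell_size N X_old X K * c K $ i)
      = (\<Sum>K=1..N. cell_size N X_old K * c_old K $ i - dt * (?J K $ i - ?J (K - 1) $ i))"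
    by (rule sum.cong[OF refl])
  also have "\<dots> = (\<Sum>K=1..N. cell_size N X_old K * c_old K $ i)
      - dt * (\<Sum>K=1..N. ?J K $ i - ?J (K - 1) $ i)"
    unfolding sum_distrib_left by (rule sum_subtractf)
  also have "(\<Sum>K=1..N. ?J K $ i - ?J (K - 1) $ i) = ?J N $ i - ?J 0 $ i"
    using sum_telescope''[OF le0, of "\<lambda>K. ?J K $ i" N] by (simp only: One_nat_def)
  finally show ?thesis using boundary_fluxes k by simp
qed

lemma interface_moves_at_most_one_cell:
  assumes "1 < interface_index N X" "interface_index N X < N"
  obtains "interface_index N X = k" | "interface_index N X = k + 1" | "interface_index N X + 1 = k"
proof -
  let ?k' = "interface_index N X"
  have "\<bar>edge N ?k' - X\<bar> \<le> dx N / 2" using interface_near_edge[of N X] assms by simp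
  then have "\<bar>edge N ?k' - edge N k\<bar> < 3 / 2 * dx N"
    using old_interface_near_edge displacement_small by linarith
  then have "\<bar>real ?k' - real k\<bar> * dx N < 3 / 2 * dx N"
    using dx_pos by (simp add: edge_def left_diff_distrib[symmetric] abs_mult)
  then have "\<bar>real ?k' - real k\<bar> < 3 / 2" using dx_pos by simp
  then have "?k' = k \<or> ?k' = k + 1 \<or> ?k' + 1 = k" by linarith
  then show thesis using that by blast
qed

text \<open>
  If the interface index changes, the post-processing splits the enlarged cell, which gives both
  parts the same value, and merges the shrunken cell with its neighbour, which takes their weighted average.
  Values stay admissible because the set of admissible values is convex, and the content of the
  three cells involved is unchanged.
\<close>

lemma post_processed:
  assumes post: "post_processing N X_old c X c_new"
    and k': "1 < interface_index N X" "interface_index N X < N"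
  shows "K \<in> {1..N} \<Longrightarrow> c_new K \<in> admissible"
    and "(\<Sum>K=1..N. cell_size N X K * c_new K $ i) = (\<Sum>K=1..N. star_cell_size N X_old X K * c K $ i)"
proof -
  let ?\<Delta> = "star_cell_size N X_old X"
  have sizes: "?\<Delta> k = X - edge N k + dx N" "?\<Delta> (k + 1) = edge N k + dx N - X"
    by (simp_all add: star_cell_size_def moved_cell_size_def k(1)[symmetric]
        edge_before_k[simplified] edge_Suc[simplified])
  have other_sizes: "?\<Delta> K = dx N" if "K \<noteq> k" "K \<noteq> k + 1" for K
    using that by (simp add: star_cell_size_def moved_cell_size_def k(1)[symmetric])
  have merged_content: "(dx N + ?\<Delta> K) * ((1 / (dx N + ?\<Delta> K)) *\<^sub>R v) $ i = v $ i" for K v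
    using dx_pos star_cell_size_pos[of K] by simp
  note post = post[unfolded post_processing_def Let_def, folded k(1)]
  have "(\<forall>K\<in>{1..N}. c_new K \<in> admissible) \<and>
    (\<Sum>K=1..N. cell_size N X K * c_new K $ i) = (\<Sum>K=1..N. ?\<Delta> K * c K $ i)"
    using k'
  proof (cases rule: interface_moves_at_most_one_cell)
    case 1
    then have "\<And>K. K \<in> {1..N} \<Longrightarrow> c_new K = c K" using post by simp
    moreover have "cell_size N X = ?\<Delta>"
      using 1 by (simp add: cell_size_def star_cell_size_def k(1)[symmetric])
    ultimately show ?thesis using admissible by simp
  next
    case 2
    then have "k + 1 < N" using k' by simp
    then have new: "c_new k = c k" "c_new (k + 1) = c k"
        "c_new (k + 2) = (1 / (dx N + ?\<Delta> (k + 1))) *\<^sub>R (?\<Delta> (k + 1) *\<^sub>R c (k + 1) + dx N *\<^sub>R c (k + 2))"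
        "\<And>K. K \<in> {1..N} - {k, k + 1, k + 2} \<Longrightarrow> c_new K = c K"
      using post 2 by auto
    have "c_new (k + 2) \<in> admissible"
      unfolding new(3) add.commute[of "?\<Delta> (k + 1) *\<^sub>R c (k + 1)"]
      using \<open>k + 1 < N\<close> dx_pos star_cell_size_pos[of "k + 1"]
      by (intro admissible_convex_combination admissible) auto
    moreover have "c k \<in> admissible" using admissible[of k] k by simp
    ultimately have "\<forall>K\<in>{1..N}. c_new K \<in> admissible"
      using new admissible by (metis DiffI empty_iff insert_iff)
    have new_sizes: "cell_size N X k = dx N" "cell_size N X (k + 1) = X - edge N k"
        "cell_size N X (k + 2) = dx N + ?\<Delta> (k + 1)"
        "\<And>K. K \<notin> {k, k + 1, k + 2} \<Longrightarrow> cell_size N X K = ?\<Delta> K"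
      using 2 sizes edge_Suc[of N "k + 1"] other_sizes
      by (simp_all add: cell_size_def moved_cell_size_def edge_Suc[simplified])
    let ?f = "\<lambda>K. cell_size N X K * c_new K $ i" and ?g = "\<lambda>K. ?\<Delta> K * c K $ i"
    have sub: "{k, k + 1, k + 2} \<subseteq> {1..N}" using \<open>k + 1 < N\<close> k by auto
    have split: "sum h {1..N} = h k + h (k + 1) + h (k + 2) + sum h ({1..N} - {k, k + 1, k + 2})"
      for h :: "nat \<Rightarrow> real"
      using sum.subset_diff[OF sub, of h] by simp
    have "sum ?f ({1..N} - {k, k + 1, k + 2}) = sum ?g ({1..N} - {k, k + 1, k + 2})"
      using new(4) new_sizes(4) by (intro sum.cong) auto
    moreover have "?f (k + 2) = ?g (k + 1) + ?g (k + 2)"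
      unfolding new_sizes(3) new(3) merged_content by (simp add: other_sizes)
    moreover have "?f k + ?f (k + 1) = ?g k"
      by (simp only: new new_sizes sizes) (simp add: algebra_simps)
    ultimately have "sum ?f {1..N} = sum ?g {1..N}" unfolding split by linarith
    then show ?thesis using \<open>\<forall>K\<in>{1..N}. c_new K \<in> admissible\<close> by simp
  next
    case 3
    \<comment> \<open>Indexed from the cell \<open>m\<close> of the new interface, so that no truncated subtraction occurs.\<close>
    define m where "m = k - 1"
    have m: "k = m + 1" "1 < m" "interface_index N X = m" using 3 k' by (auto simp: m_def)
    have new: "c_new (m + 1) = c (m + 2)" "c_new (m + 2) = c (m + 2)"
        "c_new m = (1 / (dx N + ?\<Delta> (m + 1))) *\<^sub>R (dx N *\<^sub>R c m + ?\<Delta> (m + 1) *\<^sub>R c (m + 1))"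
        "\<And>K. K \<in> {1..N} - {m, m + 1, m + 2} \<Longrightarrow> c_new K = c K"
      using post m by auto
    have "c_new m \<in> admissible"
      unfolding new(3)
      using m k dx_pos star_cell_size_pos[of "m + 1"]
      by (intro admissible_convex_combination admissible) auto
    moreover have "c (m + 2) \<in> admissible" using admissible[of "m + 2"] k m by simp
    ultimately have "\<forall>K\<in>{1..N}. c_new K \<in> admissible"
      using new admissible by (metis DiffI empty_iff insert_iff)
    have edge_m: "edge N (m - 1) = edge N m - dx N" using edge_Suc[of N "m - 1"] m by simp
    have new_sizes: "cell_size N X (m + 1) = edge N (m + 1) - X" "cell_size N X (m + 2) = dx N"
        "cell_size N X m = dx N + ?\<Delta> (m + 1)"
        "\<And>K. K \<notin> {m, m + 1, m + 2} \<Longrightarrow> cell_size N X K = ?\<Delta> K"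
      using m sizes edge_m other_sizes
      by (simp_all add: cell_size_def moved_cell_size_def edge_Suc[simplified])
    let ?f = "\<lambda>K. cell_size N X K * c_new K $ i" and ?g = "\<lambda>K. ?\<Delta> K * c K $ i"
    have sub: "{m, m + 1, m + 2} \<subseteq> {1..N}" using k m by auto
    have split: "sum h {1..N} = h m + h (m + 1) + h (m + 2) + sum h ({1..N} - {m, m + 1, m + 2})"
      for h :: "nat \<Rightarrow> real"
      using sum.subset_diff[OF sub, of h] by simp
    have "sum ?f ({1..N} - {m, m + 1, m + 2}) = sum ?g ({1..N} - {m, m + 1, m + 2})"
      using new(4) new_sizes(4) by (intro sum.cong) auto
    moreover have "?f m = ?g m + ?g (m + 1)"
      unfolding new_sizes(3) new(3) merged_content using other_sizes[of m] m(1) by simp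
    moreover have "?\<Delta> (m + 2) = edge N (m + 1) + dx N - X" using sizes(2) m(1) by simp
    then have "?f (m + 1) + ?f (m + 2) = ?g (m + 2)"
      by (simp only: new new_sizes) (simp add: algebra_simps)
    ultimately have "sum ?f {1..N} = sum ?g {1..N}" unfolding split by linarith
    then show ?thesis using \<open>\<forall>K\<in>{1..N}. c_new K \<in> admissible\<close> by simp
  qed
  then show "K \<in> {1..N} \<Longrightarrow> c_new K \<in> admissible"
    and "(\<Sum>K=1..N. cell_size N X K * c_new K $ i) = (\<Sum>K=1..N. ?\<Delta> K * c K $ i)"
    by blast+
qed

end


section \<open>Properties of the solutions\<close>

theorem lemma2:
  fixes \<kappa>s \<kappa>g :: "'n::finite \<Rightarrow> 'n \<Rightarrow> real"
    and \<mu>s \<mu>g :: "real ^ 'n"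
    and N p :: nat
    and dt :: real
    and c :: "nat \<Rightarrow> nat \<Rightarrow> real ^ 'n"
    and X :: "nat \<Rightarrow> real"
    and c_star J :: "nat \<Rightarrow> real ^ 'n"
  defines "k \<equiv> interface_index N (X (p - 1))"
  assumes "CARD('n) \<ge> 2"
    and "\<And>i j. i \<noteq> j \<Longrightarrow> \<kappa>s i j = \<kappa>s j i \<and> \<kappa>s i j > 0"
    and "\<And>i j. i \<noteq> j \<Longrightarrow> \<kappa>g i j = \<kappa>g j i \<and> \<kappa>g i j > 0"
    and "N \<ge> 1"
    and "0 < dt" and "dt < dx N / (2 * C_bound \<mu>s \<mu>g)"
    and "p \<ge> 1"
    and "\<And>K. K \<in> {1..N} \<Longrightarrow> c (p - 1) K \<in> admissible"
    and "X (p - 1) \<in> {0..1}"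
    and "1 < k" and "k < N"
    and "modified_solution \<kappa>s \<kappa>g \<mu>s \<mu>g N dt (c (p - 1)) (X (p - 1)) c_star J (c p) (X p)"
  shows "(\<forall>i. \<forall>K\<in>{1..N}. c p K $ i \<ge> 0) \<and>
    (\<forall>K\<in>{1..N}. (\<Sum>i\<in>UNIV. c p K $ i) = 1) \<and>
    (\<forall>i. (\<Sum>K=1..N. cell_size N (X p) K * c p K $ i)
          = (\<Sum>K=1..N. cell_size N (X (p - 1)) K * c (p - 1) K $ i)) \<and>
    J_solid \<mu>s \<mu>g k c_star = J_gas \<mu>s \<mu>g k c_star \<and>
    (\<forall>K\<in>{1..N}. diamond (c_star K) = c_star K) \<and>
    solution \<kappa>s \<kappa>g \<mu>s \<mu>g N dt (c (p - 1)) (X (p - 1))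
      c_star (J(k := J_solid \<mu>s \<mu>g k c_star)) (c p) (X p) \<and>
    (\<forall>K. k < K \<and> K \<le> N - 1 \<longrightarrow> invertible (A_reg \<kappa>g (edge_value c_star K)))"
proof -
  have mod: "modified_scheme \<kappa>s \<kappa>g \<mu>s \<mu>g N dt (c (p - 1)) (X (p - 1)) c_star (X p) J"
    and post: "post_processing N (X (p - 1)) c_star (X p) (c p)"
    and k': "1 < interface_index N (X p)" "interface_index N (X p) < N"
    using assms(13) by (auto simp: modified_solution_def)
  interpret modified_step \<kappa>s \<kappa>g \<mu>s \<mu>g N k dt "X (p - 1)" "X p" "c (p - 1)" c_star J
    by unfold_locales (use assms mod in auto)
  show ?thesis
  proof (intro conjI allI ballI impI)
    fix K assume "K \<in> {1..N}"
    then have "c p K \<in> admissible" by (rule post_processed(1)[OF post k'])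
    then show "(\<Sum>i\<in>UNIV. c p K $ i) = 1" "\<And>i. c p K $ i \<ge> 0" by (auto simp: admissible_def)
    show "diamond (c_star K) = c_star K" using \<open>K \<in> {1..N}\<close> by (rule diamond_eq)
  next
    fix i
    show "(\<Sum>K=1..N. cell_size N (X p) K * c p K $ i)
        = (\<Sum>K=1..N. cell_size N (X (p - 1)) K * c (p - 1) K $ i)"
      using post_processed(2)[OF post k'] star_mass by simp
  next
    show "J_solid \<mu>s \<mu>g k c_star = J_gas \<mu>s \<mu>g k c_star" by (simp add: J_solid_eq J_gas_eq)
  next
    show "solution \<kappa>s \<kappa>g \<mu>s \<mu>g N dt (c (p - 1)) (X (p - 1))
        c_star (J(k := J_solid \<mu>s \<mu>g k c_star)) (c p) (X p)"
      using scheme post k' by (simp add: solution_def)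
  next
    fix K
    show "invertible (A_reg \<kappa>g (edge_value c_star K))"
      using \<kappa>g kappa_min_pos(2) edge_value_nonneg by (intro invertible_A_reg) auto
  qed
qed

end
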